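(* Let $\mathbf{P}\in\mathbb{R}^3$, $\mathbf{P}\neq\mathbf{O}$, be a point lying neither on the ray $\overrightarrow{\mathbf{O}\mathbf{F}}$ nor on the ray $\overrightarrow{\mathbf{O}\mathbf{B}}$. Let $P=p(\mathbf{P})$ be its perspective image and let $P^\star=p(\mathbf{P}^\star)$ be the perspective image of its antipode. Then $P^\star$ is the point on the ray $\overrightarrow{PF}$ (the ray from $P$ through $F$) such that $|PP^\star|=r$, where $r$ is the radius of the perspective disc.
   Context: Total spherical perspective: $\mathbf{O}$ is the origin of $\mathbb{R}^3$ with orthonormal coordinates $x,y,z$; $S^2$ is the unit sphere centered at $\mathbf{O}$; $\mathbf{F}=(0,1,0)$ and $\mathbf{B}=(0,-1,0)$. An $\mathbf{F}$-meridian is a half great circle of $S^2$ with endpoints $\mathbf{F}$ and $\mathbf{B}$. The perspective disc is the open disc $D\subset\mathbb{R}^2$ (coordinates $(x,z)$) of radius $r$ centered at the origin; its size is arbitrary up to a choice of scale factor ($r=\pi$ for unit scale). The flattening $\pi:S^2\setminus\{\mathbf{B}\}\to D$ is the azimuthal equidistant projection: the homeomorphism that maps each $\mathbf{F}$-meridian (minus $\mathbf{B}$) to a line segment, preserves distances along each $\mathbf{F}$-meridian up to the common scale factor $r/\pi$ (here $\pi$ is the number), and preserves angles at $\mathbf{F}$ between $\mathbf{F}$-meridians. The perspective $p$ of a point $\mathbf{P}=(x,y,z)$ not on the ray $\overrightarrow{\mathbf{O}\mathbf{B}}$ is the flattening of $\mathbf{P}/|\mathbf{P}|$; explicitly $$p(x,y,z)=\frac{r}{\pi}\,\frac{(x,z)}{\sqrt{x^2+z^2}}\arccos\!\left(\frac{y}{\sqrt{x^2+y^2+z^2}}\right)\quad\text{if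 }(x,z)\neq(0,0),$$ and $p$ of a point of the open ray from $\mathbf{O}$ through $\mathbf{F}$ is $F=(0,0)$. The antipode $\mathbf{P}^\star$ of a point of $S^2$ is the diametrically opposite point $-\mathbf{P}$; for a spatial point $\mathbf{P}\neq\mathbf{O}$, $\mathbf{P}^\star$ is the antipode of $\mathbf{P}/|\mathbf{P}|$. Bold letters denote spatial points and the corresponding italic letters their perspective images. *)

theory Defs
  imports "HOL-Analysis.Analysis"
begin

text \<open>Space is \<^typ>\<open>real^3\<close> with components 1, 2, 3 for \<open>x\<close>, \<open>y\<close>, \<open>z\<close>; the plane of the
  perspective disc is \<^typ>\<open>real^2\<close> with components 1, 2 for \<open>x\<close>, \<open>z\<close>.\<close>

definition ptF :: "real^3" where
  "ptF = vector [0, 1, 0]"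

definition ptB :: "real^3" where
  "ptB = vector [0, -1, 0]"

text \<open>Rays are closed: the starting point \<open>A\<close> belongs to \<open>ray A C\<close>.\<close>

definition ray :: "'a::real_vector \<Rightarrow> 'a \<Rightarrow> 'a set" where
  "ray A C = {A + t *\<^sub>R (C - A) | t. 0 \<le> t}"

definition antipode :: "real^3 \<Rightarrow> real^3" where
  "antipode P = - (P /\<^sub>R norm P)"

text \<open>Azimuthal equidistant projection of the unit sphere minus \<^const>\<open>ptB\<close> onto the open disc
  of radius \<open>r\<close>. The first case is meant for \<^const>\<open>ptF\<close>; the value \<open>0\<close> that it also gives
  at \<^const>\<open>ptB\<close>, which is outside the domain, is a dummy.\<close>

definition flattening :: "real \<Rightarrow> real^3 \<Rightarrow> real^2" where
  "flattening r Q =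
     (if Q $ 1 = 0 \<and> Q $ 3 = 0 then 0
      else (r / pi * arccos (Q $ 2)) *\<^sub>R
             (vector [Q $ 1, Q $ 3] /\<^sub>R sqrt ((Q $ 1)\<^sup>2 + (Q $ 3)\<^sup>2)))"

definition perspective :: "real \<Rightarrow> real^3 \<Rightarrow> real^2" where
  "perspective r P = flattening r (P /\<^sub>R norm P)"

text \<open>The next lemma determines \<^const>\<open>flattening\<close>: \<open>\<theta>\<close> is arc length from \<^const>\<open>ptF\<close> along
  the meridian with direction \<open>\<phi>\<close>. So meridians go to radii, lengths along them are scaled by
  \<open>r / pi\<close>, and the angles between them at \<^const>\<open>ptF\<close> are preserved.\<close>

lemma flattening_meridian:
  assumes "0 \<le> \<theta>" "\<theta> < pi"
  shows "flattening r (vector [sin \<theta> * cos \<phi>, cos \<theta>, sin \<theta> * sin \<phi>])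
           = (r / pi * \<theta>) *\<^sub>R vector [cos \<phi>, sin \<phi>]"
proof (cases "\<theta> = 0")
  case True
  then show ?thesis by (simp add: flattening_def)
next
  case False
  with assms have s: "sin \<theta> > 0" by (simp add: sin_gt_zero)
  have nz: "\<not> (cos \<phi> = 0 \<and> sin \<phi> = 0)"
    using sin_zero_abs_cos_one by fastforce
  have "(sin \<theta> * cos \<phi>)\<^sup>2 + (sin \<theta> * sin \<phi>)\<^sup>2 = (sin \<theta>)\<^sup>2 * ((cos \<phi>)\<^sup>2 + (sin \<phi>)\<^sup>2)"
    by (simp only: distrib_left power_mult_distrib)
  also have "\<dots> = (sin \<theta>)\<^sup>2"
    by simp
  finally have q: "sqrt ((sin \<theta> * cos \<phi>)\<^sup>2 + (sin \<theta> * sin \<phi>)\<^sup>2) = sin \<theta>"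
    using s by (simp only: real_sqrt_abs abs_of_pos)
  have a: "arccos (cos \<theta>) = \<theta>"
    using assms by (simp add: arccos_cos)
  show ?thesis
    using s nz by (auto simp: flattening_def q a vec_eq_iff forall_2 vector_2 vector_3)
qed

lemma perspective_explicit:
  assumes "(P $ 1, P $ 3) \<noteq> (0, 0)"
  shows "perspective r P =
    (r / pi * arccos (P $ 2 / sqrt ((P $ 1)\<^sup>2 + (P $ 2)\<^sup>2 + (P $ 3)\<^sup>2))
       / sqrt ((P $ 1)\<^sup>2 + (P $ 3)\<^sup>2)) *\<^sub>R vector [P $ 1, P $ 3]"
proof -
  have n: "norm P = sqrt ((P $ 1)\<^sup>2 + (P $ 2)\<^sup>2 + (P $ 3)\<^sup>2)"
    by (simp add: norm_vec_def L2_set_def sum_3)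
  have p: "norm P > 0"
    using assms by auto
  have "(P $ 1 / norm P)\<^sup>2 + (P $ 3 / norm P)\<^sup>2 = ((P $ 1)\<^sup>2 + (P $ 3)\<^sup>2) / (norm P)\<^sup>2"
    by (simp add: power_divide add_divide_distrib)
  then have q: "sqrt ((P $ 1 / norm P)\<^sup>2 + (P $ 3 / norm P)\<^sup>2)
                  = sqrt ((P $ 1)\<^sup>2 + (P $ 3)\<^sup>2) / norm P"
    by (simp add: real_sqrt_divide)
  show ?thesis
    unfolding n[symmetric] using p assms q
    by (auto simp: perspective_def flattening_def vec_eq_iff forall_2 vector_2 divide_inverse
        mult.commute mult.left_commute)
qed

lemma perspective_F_ray:
  assumes "P \<in> ray 0 ptF"
  shows "perspective r P = 0"
  using assms by (auto simp: ray_def ptF_def perspective_def flattening_def vector_3)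

end

theory Submission
  imports Defs
begin

text \<open>Let \<open>u\<close> be the unit vector in the plane that points along the meridian of the unit
  vector \<open>Q = P / |P|\<close>, and \<open>\<theta> = arccos (Q $ 2)\<close> its angular distance from \<^const>\<open>ptF\<close>.
  Then \<open>Q\<close> is flattened to \<open>(r / pi * \<theta>) u\<close>. Its antipode lies on the opposite meridian, with
  direction \<open>- u\<close>, at angular distance \<open>pi - \<theta>\<close> from \<^const>\<open>ptF\<close>, so it is flattened to
  \<open>- (r / pi * (pi - \<theta>)) u = (r / pi * \<theta>) u - r u\<close>: from the image of \<open>Q\<close> one moves by \<open>r\<close> in the
  direction \<open>- u\<close>. Off the axis \<open>\<theta> > 0\<close>, so this is the direction from the image of \<open>Q\<close>
  towards \<open>0\<close>, the image of \<^const>\<open>ptF\<close> (\<open>flattening_antipodal\<close>). A nondegenerate ray has only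
  one point at a given distance from its starting point (\<open>ray_points_at_distance\<close>).\<close>

lemma ray_points_at_distance:
  fixes A C :: "'a::real_normed_vector"
  assumes "A \<noteq> C" "0 \<le> d"
  shows "{Q \<in> ray A C. dist A Q = d} = {A + (d / dist A C) *\<^sub>R (C - A)}"
proof -
  have pos: "norm (C - A) > 0"
    using assms(1) by simp
  have iff: "dist A (A + t *\<^sub>R (C - A)) = d \<longleftrightarrow> t = d / dist A C" if "0 \<le> t" for t
    using pos that unfolding dist_norm norm_minus_commute[of A C] by (simp add: eq_divide_eq)
  have "0 \<le> d / dist A C"
    using assms(2) by simp
  then show ?thesis
    using iff by (fastforce simp: ray_def)
qed

lemma axis_eq_rays: "{P. P $ 1 = 0 \<and> P $ 3 = 0} = ray 0 ptF \<union> ray 0 ptB"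
proof (intro equalityI subsetI)
  fix P :: "real^3"
  assume "P \<in> {P. P $ 1 = 0 \<and> P $ 3 = 0}"
  then have "P = (P $ 2) *\<^sub>R ptF" "P = (- P $ 2) *\<^sub>R ptB"
    by (simp_all add: ptF_def ptB_def vec_eq_iff forall_3 vector_3)
  moreover have "0 \<le> P $ 2 \<or> 0 \<le> - P $ 2"
    by simp linarith
  ultimately show "P \<in> ray 0 ptF \<union> ray 0 ptB"
    unfolding ray_def by (metis (mono_tags, lifting) UnI1 UnI2 add_0 diff_zero mem_Collect_eq)
qed (auto simp: ray_def ptF_def ptB_def vector_3)

text \<open>The radii of the images of \<open>Q\<close> and \<open>- Q\<close> add up to \<open>r\<close>, because
  \<open>arccos y + arccos (- y) = pi\<close>. The scalar factor says that the image of \<open>- Q\<close> is reached from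
  the image of \<open>Q\<close> by a step of length \<open>r\<close> towards the origin.\<close>

lemma flattening_antipodal:
  assumes "0 < r" "norm Q = 1" "\<not> (Q $ 1 = 0 \<and> Q $ 3 = 0)"
  shows "flattening r Q \<noteq> 0"
    and "flattening r (- Q) = flattening r Q - (r / norm (flattening r Q)) *\<^sub>R flattening r Q"
proof -
  define s where "s = sqrt ((Q $ 1)\<^sup>2 + (Q $ 3)\<^sup>2)"
  define u :: "real^2" where "u = vector [Q $ 1, Q $ 3] /\<^sub>R s"
  define \<theta> where "\<theta> = arccos (Q $ 2)"
  have s: "s > 0"
    using assms(3) by (auto simp: s_def sum_power2_gt_zero_iff)
  have "norm (vector [Q $ 1, Q $ 3] :: real^2) = s"
    by (simp add: s_def norm_vec_def L2_set_def sum_2 vector_2)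
  then have u: "norm u = 1"
    using s by (simp add: u_def)
  have "(norm Q)\<^sup>2 = (Q $ 1)\<^sup>2 + (Q $ 2)\<^sup>2 + (Q $ 3)\<^sup>2"
    by (simp add: norm_vec_def L2_set_def sum_3 add_nonneg_nonneg)
  moreover have "(Q $ 1)\<^sup>2 + (Q $ 3)\<^sup>2 > 0"
    using assms(3) by (simp add: sum_power2_gt_zero_iff)
  ultimately have "(Q $ 2)\<^sup>2 < 1"
    using assms(2) by simp
  then have y: "- 1 < Q $ 2" "Q $ 2 < 1"
    by (auto simp: abs_square_less_1 abs_less_iff)
  have \<theta>: "\<theta> > 0"
    using arccos_lt_bounded[OF y] by (simp add: \<theta>_def)
  have Q: "flattening r Q = (r / pi * \<theta>) *\<^sub>R u"
    using assms(3) by (auto simp: flattening_def u_def s_def \<theta>_def)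
  have nQ: "norm (flattening r Q) = r / pi * \<theta>"
    using assms(1) \<theta> by (simp add: Q u)
  show "flattening r Q \<noteq> 0"
    using nQ assms(1) \<theta> by force
  have "vector [- Q $ 1, - Q $ 3] /\<^sub>R s = - u"
    by (simp add: u_def vec_eq_iff forall_2 vector_2)
  moreover have "arccos (- Q $ 2) = pi - \<theta>"
    using y by (simp add: \<theta>_def arccos_minus)
  ultimately have "flattening r (- Q) = (r / pi * (pi - \<theta>)) *\<^sub>R (- u)"
    using assms(3) by (auto simp: flattening_def s_def)
  also have "\<dots> = (r / pi * \<theta> - r) *\<^sub>R u"
    unfolding scaleR_minus_right scaleR_minus_left[symmetric]
    by (rule arg_cong[where f = "\<lambda>c. c *\<^sub>R u"]) (simp add: field_simps)
  also have "\<dots> = flattening r Q - r *\<^sub>R u"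
    by (simp add: Q scaleR_diff_left)
  also have "r *\<^sub>R u = (r / norm (flattening r Q)) *\<^sub>R flattening r Q"
    unfolding nQ unfolding Q using assms(1) \<theta> by simp
  finally show "flattening r (- Q)
      = flattening r Q - (r / norm (flattening r Q)) *\<^sub>R flattening r Q" .
qed

theorem proposition2:
  fixes r :: real and P :: "real^3"
  assumes "r > 0"
    and "P \<noteq> 0"
    and "P \<notin> ray 0 ptF"
    and "P \<notin> ray 0 ptB"
  shows "{Q \<in> ray (perspective r P) (perspective r ptF). dist (perspective r P) Q = r}
           = {perspective r (antipode P)}"
proof -
  define Q where "Q = P /\<^sub>R norm P"
  have nQ: "norm Q = 1"
    using assms(2) by (simp add: Q_def)
  have "\<not> (P $ 1 = 0 \<and> P $ 3 = 0)"
    using axis_eq_rays assms(3,4) by blast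
  then have off_axis: "\<not> (Q $ 1 = 0 \<and> Q $ 3 = 0)"
    using assms(2) by (simp add: Q_def)
  note antipodal = flattening_antipodal[OF assms(1) nQ off_axis]
  have F: "perspective r ptF = 0"
    by (rule perspective_F_ray) (auto simp: ray_def intro: exI[of _ 1])
  have P: "perspective r P = flattening r Q"
    by (simp add: perspective_def Q_def)
  have "perspective r (antipode P) = flattening r (- Q)"
    using nQ by (simp add: perspective_def antipode_def flip: Q_def)
  also have "\<dots> = flattening r Q + (r / dist (flattening r Q) 0) *\<^sub>R (0 - flattening r Q)"
    by (simp add: antipodal(2))
  finally show ?thesis
    using ray_points_at_distance[of "flattening r Q" 0 r] antipodal(1) assms(1)
    unfolding F P by simp
qed

end
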